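(* Let $\mathcal{E}$ and $\mathcal{F}$ be qubit channels such that $\mathcal{E}$ is 2-LEA and $\mathcal{F}$ is entanglement-breaking. Then for every $\mu\in[0,1]$ the convex combination $\mu\mathcal{E}+(1-\mu)\mathcal{F}$ is 2-LEA.
   Context: A qubit channel is a completely positive trace-preserving linear map on $M_2(\mathbb{C})$. A state is a positive semidefinite operator of trace one. A two-qubit channel is called entanglement-annihilating (EA) if it maps every state on $\mathbb{C}^2\otimes\mathbb{C}^2$ to a state that is separable with respect to the partition qubit 1 | qubit 2. A qubit channel $\mathcal{E}$ is called 2-locally entanglement-annihilating (2-LEA) if $\mathcal{E}\otimes\mathcal{E}$ is EA. A channel $\mathcal{F}$ is called entanglement-breaking (EB) if for every finite-dimensional ancilla and every state $\rho$ of system plus ancilla, $(\mathcal{F}\otimes\mathcal{I}_{\rm anc})[\rho]$ is separable with respect to the partition system | ancilla, where $\mathcal{I}_{\rm anc}$ is the identity channel on the ancilla. *)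

theory Defs
  imports Complex_Main "Jordan_Normal_Form.Matrix"
begin

text \<open>
  Operators on a \<open>d\<close>-dimensional Hilbert space are the elements of \<open>carrier_mat d d\<close>.
  The basis vector \<open>e_i \<otimes> e_k\<close> of the tensor product of an \<open>m\<close>- and an \<open>n\<close>-dimensional space
  has index \<open>i * n + k\<close>.
\<close>

definition kron :: "complex mat \<Rightarrow> complex mat \<Rightarrow> complex mat" where
  "kron A B = mat (dim_row A * dim_row B) (dim_col A * dim_col B)
     (\<lambda>(r, c). A $$ (r div dim_row B, c div dim_col B) * B $$ (r mod dim_row B, c mod dim_col B))"

definition mat_trace :: "complex mat \<Rightarrow> complex" where
  "mat_trace A = (\<Sum>i<dim_row A. A $$ (i, i))"

text \<open>
  The order on \<open>complex\<close> is that of \<open>Complex_Order\<close>, so \<open>0 \<le> z\<close> says that \<open>z\<close> is real and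
  nonnegative; this makes the matrix Hermitian.
\<close>

definition psd :: "nat \<Rightarrow> complex mat \<Rightarrow> bool" where
  "psd d A \<longleftrightarrow> A \<in> carrier_mat d d \<and> (\<forall>v \<in> carrier_vec d. 0 \<le> (A *\<^sub>v v) \<bullet>c v)"

definition state :: "nat \<Rightarrow> complex mat \<Rightarrow> bool" where
  "state d \<rho> \<longleftrightarrow> psd d \<rho> \<and> mat_trace \<rho> = 1"

definition separable :: "nat \<Rightarrow> nat \<Rightarrow> complex mat \<Rightarrow> bool" where
  "separable m n \<rho> \<longleftrightarrow>
     (\<exists>(K::nat) (p :: nat \<Rightarrow> real) \<sigma> \<tau>.
        (\<forall>k<K. 0 \<le> p k \<and> state m (\<sigma> k) \<and> state n (\<tau> k)) \<and> (\<Sum>k<K. p k) = 1 \<and>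
        \<rho> = mat (m * n) (m * n) (\<lambda>rc. \<Sum>k<K. complex_of_real (p k) * kron (\<sigma> k) (\<tau> k) $$ rc))"

text \<open>A map on operators is represented by a function whose values outside
  \<open>carrier_mat d d\<close> are irrelevant.\<close>

definition linear_op :: "nat \<Rightarrow> (complex mat \<Rightarrow> complex mat) \<Rightarrow> bool" where
  "linear_op d \<Phi> \<longleftrightarrow>
     (\<forall>A \<in> carrier_mat d d. \<Phi> A \<in> carrier_mat d d) \<and>
     (\<forall>A \<in> carrier_mat d d. \<forall>B \<in> carrier_mat d d. \<Phi> (A + B) = \<Phi> A + \<Phi> B) \<and>
     (\<forall>A \<in> carrier_mat d d. \<forall>z. \<Phi> (z \<cdot>\<^sub>m A) = z \<cdot>\<^sub>m \<Phi> A)"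

definition mat_unit :: "nat \<Rightarrow> nat \<Rightarrow> nat \<Rightarrow> complex mat" where
  "mat_unit d i j = mat d d (\<lambda>rc. if rc = (i, j) then 1 else 0)"

text \<open>
  The tensor product of linear maps on \<open>carrier_mat m m\<close> and \<open>carrier_mat n n\<close>: the linear
  extension of \<open>E_ij \<otimes> E_kl \<mapsto> \<Phi> E_ij \<otimes> \<Psi> E_kl\<close>, with \<open>E_ij\<close> the matrix units
  (see \<open>tensor_map_kron\<close> below).
\<close>

definition tensor_map ::
  "nat \<Rightarrow> nat \<Rightarrow> (complex mat \<Rightarrow> complex mat) \<Rightarrow> (complex mat \<Rightarrow> complex mat) \<Rightarrow> complex mat \<Rightarrow> complex mat"
where
  "tensor_map m n \<Phi> \<Psi> X = mat (m * n) (m * n) (\<lambda>rc.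
     \<Sum>i<m. \<Sum>j<m. \<Sum>k<n. \<Sum>l<n.
       X $$ (i * n + k, j * n + l) * kron (\<Phi> (mat_unit m i j)) (\<Psi> (mat_unit n k l)) $$ rc)"

definition completely_positive :: "nat \<Rightarrow> (complex mat \<Rightarrow> complex mat) \<Rightarrow> bool" where
  "completely_positive d \<Phi> \<longleftrightarrow>
     (\<forall>n. \<forall>X. psd (d * n) X \<longrightarrow> psd (d * n) (tensor_map d n \<Phi> id X))"

definition channel :: "nat \<Rightarrow> (complex mat \<Rightarrow> complex mat) \<Rightarrow> bool" where
  "channel d \<Phi> \<longleftrightarrow> linear_op d \<Phi> \<and> completely_positive d \<Phi> \<and>
     (\<forall>A \<in> carrier_mat d d. mat_trace (\<Phi> A) = mat_trace A)"

definition entanglement_annihilating :: "(complex mat \<Rightarrow> complex mat) \<Rightarrow> bool" where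
  "entanglement_annihilating \<Phi> \<longleftrightarrow> channel (2 * 2) \<Phi> \<and>
     (\<forall>\<rho>. state (2 * 2) \<rho> \<longrightarrow> separable 2 2 (\<Phi> \<rho>))"

definition two_LEA :: "(complex mat \<Rightarrow> complex mat) \<Rightarrow> bool" where
  "two_LEA \<Phi> \<longleftrightarrow> channel 2 \<Phi> \<and> entanglement_annihilating (tensor_map 2 2 \<Phi> \<Phi>)"

definition entanglement_breaking :: "nat \<Rightarrow> (complex mat \<Rightarrow> complex mat) \<Rightarrow> bool" where
  "entanglement_breaking d \<Phi> \<longleftrightarrow> channel d \<Phi> \<and>
     (\<forall>n\<ge>1. \<forall>\<rho>. state (d * n) \<rho> \<longrightarrow> separable d n (tensor_map d n \<Phi> id \<rho>))"

lemma kron_carrier: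
  "A \<in> carrier_mat a b \<Longrightarrow> B \<in> carrier_mat c d \<Longrightarrow> kron A B \<in> carrier_mat (a * c) (b * d)"
  by (auto simp: kron_def)

lemma pair_index_less: "i < m \<Longrightarrow> k < n \<Longrightarrow> i * n + k < m * (n::nat)"
proof -
  assume "i < m" "k < n"
  then have "i * n + k < Suc i * n" by simp
  also have "\<dots> \<le> m * n" using \<open>i < m\<close> by (intro mult_right_mono) auto
  finally show ?thesis .
qed

lemma kron_index:
  assumes "A \<in> carrier_mat m m" "B \<in> carrier_mat n n" "i < m" "j < m" "k < n" "l < n"
  shows "kron A B $$ (i * n + k, j * n + l) = A $$ (i, j) * B $$ (k, l)"
  using assms pair_index_less[of i m k n] pair_index_less[of j m l n]
  by (auto simp: kron_def)

lemma mat_unit_carrier: "mat_unit d i j \<in> carrier_mat d d"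
  by (simp add: mat_unit_def)

lemma linear_op_carrier: "linear_op d \<Phi> \<Longrightarrow> A \<in> carrier_mat d d \<Longrightarrow> \<Phi> A \<in> carrier_mat d d"
  by (auto simp: linear_op_def)

lemma linear_op_expand_aux:
  assumes lin: "linear_op d \<Phi>" and fin: "finite S"
    and r: "r < d" and c: "c < d"
  shows "\<Phi> (mat d d (\<lambda>rc. if rc \<in> S then A $$ rc else 0)) $$ (r, c)
    = (\<Sum>s\<in>S. A $$ s * \<Phi> (mat_unit d (fst s) (snd s)) $$ (r, c))"
  using fin
proof (induction S)
  case empty
  let ?Z = "0\<^sub>m d d :: complex mat"
  have z: "mat d d (\<lambda>rc. if rc \<in> {} then A $$ rc else 0) = ?Z"
    by (intro eq_matI) auto
  have "\<Phi> (0 \<cdot>\<^sub>m ?Z) = 0 \<cdot>\<^sub>m \<Phi> ?Z"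
    using lin unfolding linear_op_def by (metis zero_carrier_mat)
  moreover have "0 \<cdot>\<^sub>m ?Z = ?Z" by (intro eq_matI) auto
  ultimately have "\<Phi> ?Z = 0 \<cdot>\<^sub>m \<Phi> ?Z" by simp
  moreover have "\<Phi> ?Z \<in> carrier_mat d d" using lin by (simp add: linear_op_def)
  ultimately have "\<Phi> ?Z $$ (r, c) = 0" using r c
    by (metis carrier_matD index_smult_mat(1) mult_zero_left)
  then show ?case using z by simp
next
  case (insert s S)
  let ?M = "mat d d (\<lambda>rc. if rc \<in> S then A $$ rc else 0)"
  let ?U = "mat_unit d (fst s) (snd s)"
  have "mat d d (\<lambda>rc. if rc \<in> insert s S then A $$ rc else 0) = A $$ s \<cdot>\<^sub>m ?U + ?M"
    using insert.hyps by (intro eq_matI) (auto simp: mat_unit_def)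
  moreover have "\<Phi> (A $$ s \<cdot>\<^sub>m ?U + ?M) = A $$ s \<cdot>\<^sub>m \<Phi> ?U + \<Phi> ?M"
    using lin mat_unit_carrier[of d "fst s" "snd s"] by (auto simp: linear_op_def)
  moreover have "\<Phi> ?U \<in> carrier_mat d d" "\<Phi> ?M \<in> carrier_mat d d"
    using lin mat_unit_carrier[of d "fst s" "snd s"] by (auto simp: linear_op_def)
  ultimately show ?case using insert r c by simp
qed

lemma linear_op_expand:
  assumes lin: "linear_op d \<Phi>" and A: "A \<in> carrier_mat d d" and r: "r < d" and c: "c < d"
  shows "\<Phi> A $$ (r, c) = (\<Sum>i<d. \<Sum>j<d. A $$ (i, j) * \<Phi> (mat_unit d i j) $$ (r, c))"
proof -
  have "mat d d (\<lambda>rc. if rc \<in> {..<d} \<times> {..<d} then A $$ rc else 0) = A"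
    using A by (intro eq_matI) auto
  then show ?thesis
    using linear_op_expand_aux[OF lin _ r c, of "{..<d} \<times> {..<d}" A]
    by (simp add: sum.cartesian_product case_prod_unfold)
qed

lemma tensor_map_kron:
  assumes \<Phi>: "linear_op m \<Phi>" and \<Psi>: "linear_op n \<Psi>"
    and A: "A \<in> carrier_mat m m" and B: "B \<in> carrier_mat n n"
  shows "tensor_map m n \<Phi> \<Psi> (kron A B) = kron (\<Phi> A) (\<Psi> B)"
proof (rule eq_matI)
  have PA: "\<Phi> A \<in> carrier_mat m m" and PB: "\<Psi> B \<in> carrier_mat n n"
    using assms by (auto intro: linear_op_carrier)
  then have carr: "kron (\<Phi> A) (\<Psi> B) \<in> carrier_mat (m * n) (m * n)"
    by (rule kron_carrier)
  show "dim_row (tensor_map m n \<Phi> \<Psi> (kron A B)) = dim_row (kron (\<Phi> A) (\<Psi> B))"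
    and "dim_col (tensor_map m n \<Phi> \<Psi> (kron A B)) = dim_col (kron (\<Phi> A) (\<Psi> B))"
    using carr by (auto simp: tensor_map_def)
  fix r c assume "r < dim_row (kron (\<Phi> A) (\<Psi> B))" "c < dim_col (kron (\<Phi> A) (\<Psi> B))"
  then have rc: "r < m * n" "c < m * n" using carr by auto
  then have n: "n > 0" by (cases n) auto
  define r1 c1 r2 c2 where d: "r1 = r div n" "c1 = c div n" "r2 = r mod n" "c2 = c mod n"
  have b: "r1 < m" "c1 < m" "r2 < n" "c2 < n"
    using rc n by (auto simp: d less_mult_imp_div_less)
  have rc': "r = r1 * n + r2" "c = c1 * n + c2" by (auto simp: d)
  have "tensor_map m n \<Phi> \<Psi> (kron A B) $$ (r, c) =
     (\<Sum>i<m. \<Sum>j<m. \<Sum>k<n. \<Sum>l<n. (A $$ (i, j) * B $$ (k, l)) *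
        (\<Phi> (mat_unit m i j) $$ (r1, c1) * \<Psi> (mat_unit n k l) $$ (r2, c2)))"
    using rc unfolding tensor_map_def rc'
    by (simp add: kron_index[OF A B] b
        kron_index[OF linear_op_carrier[OF \<Phi> mat_unit_carrier] linear_op_carrier[OF \<Psi> mat_unit_carrier]])
  also have "\<dots> = (\<Sum>i<m. \<Sum>j<m. A $$ (i, j) * \<Phi> (mat_unit m i j) $$ (r1, c1)) *
       (\<Sum>k<n. \<Sum>l<n. B $$ (k, l) * \<Psi> (mat_unit n k l) $$ (r2, c2))"
    unfolding sum_distrib_right unfolding sum_distrib_left
    by (simp add: mult_ac)
  also have "\<dots> = \<Phi> A $$ (r1, c1) * \<Psi> B $$ (r2, c2)"
    using linear_op_expand[OF \<Phi> A b(1,2)] linear_op_expand[OF \<Psi> B b(3,4)] by simp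
  also have "\<dots> = kron (\<Phi> A) (\<Psi> B) $$ (r, c)"
    unfolding rc' using kron_index[OF PA PB b(1,2,3,4)] by simp
  finally show "tensor_map m n \<Phi> \<Psi> (kron A B) $$ (r, c) = kron (\<Phi> A) (\<Psi> B) $$ (r, c)" .
qed

end

(* With G = mu E + (1 - mu) F, expand G (x) G = mu (mu E (x) E + (1 - mu) E (x) F) + (1 - mu) F (x) G.
   Entanglement-annihilating maps form a convex set and E (x) E is one of them, so it is enough that
   F (x) Phi and Phi (x) F are entanglement-annihilating for every channel Phi. The map F (x) id
   already produces a separable state, which the local channel id (x) Phi keeps separable; the flip
   of the two qubits exchanges the cases. Complete positivity of tensor products is obtained from
   Phi (x) Psi = flip o (Psi (x) id) o flip o (Phi (x) id). *)
theory Submission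
  imports Defs
begin

subsection \<open>Linear maps and their tensor products\<close>

text \<open>The predicate \<open>entanglement_annihilating\<close> contains being a channel, so
  every tensor product of maps that occurs needs a proof of complete positivity besides the
  separability of its outputs. The obstacle is that \<open>completely_positive\<close> attaches the
  ancilla on the right only. A map acting on the left factor is then easy, since a further ancilla
  merges with the right factor by associativity, but a map acting on the right factor has the
  spectator on the wrong side. Hence the flip is made a channel in its own right; its complete
  positivity is elementary because it only permutes basis indices.

  Identities between tensor products of maps are tested on Kronecker products, which include all
  matrix units. They hold on operators of the right size only, so properties pass from one map to
  another through congruence lemmas rather than through equality of functions.

  Expanding one tensor factor at a time keeps G whole in F (x) G. There G enters only as some
  channel next to F, which covers F (x) E and F (x) F at once.\<close>

lemma linear_op_sum:
  assumes lin: "linear_op d \<Phi>" and A: "\<And>k. k \<in> S \<Longrightarrow> A k \<in> carrier_mat d d"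
  shows "\<Phi> (mat d d (\<lambda>rc. \<Sum>k\<in>S. c k * A k $$ rc)) = mat d d (\<lambda>rc. \<Sum>k\<in>S. c k * \<Phi> (A k) $$ rc)"
proof (rule eq_matI)
  let ?M = "mat d d (\<lambda>rc. \<Sum>k\<in>S. c k * A k $$ rc)"
  have M: "?M \<in> carrier_mat d d" by simp
  fix r s assume "r < dim_row (mat d d (\<lambda>rc. \<Sum>k\<in>S. c k * \<Phi> (A k) $$ rc))"
    "s < dim_col (mat d d (\<lambda>rc. \<Sum>k\<in>S. c k * \<Phi> (A k) $$ rc))"
  then have r: "r < d" and s: "s < d" by auto
  \<comment> \<open>Both sides are compared after expansion in matrix units, where linearity becomes
    an exchange of finite sums.\<close>
  have "\<Phi> ?M $$ (r, s) =
      (\<Sum>i<d. \<Sum>j<d. \<Sum>k\<in>S. c k * (A k $$ (i, j) * \<Phi> (mat_unit d i j) $$ (r, s)))"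
    by (subst linear_op_expand[OF lin M r s]) (simp add: sum_distrib_right mult.assoc)
  also have "\<dots> = (\<Sum>i<d. \<Sum>k\<in>S. \<Sum>j<d. c k * (A k $$ (i, j) * \<Phi> (mat_unit d i j) $$ (r, s)))"
    by (intro sum.cong refl sum.swap)
  also have "\<dots> = (\<Sum>k\<in>S. c k * (\<Sum>i<d. \<Sum>j<d. A k $$ (i, j) * \<Phi> (mat_unit d i j) $$ (r, s)))"
    by (subst sum.swap) (simp add: sum_distrib_left)
  also have "\<dots> = (\<Sum>k\<in>S. c k * \<Phi> (A k) $$ (r, s))"
    using linear_op_expand[OF lin A r s] by (intro sum.cong) auto
  finally show "\<Phi> ?M $$ (r, s) = mat d d (\<lambda>rc. \<Sum>k\<in>S. c k * \<Phi> (A k) $$ rc) $$ (r, s)"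
    using r s by simp
qed (use linear_op_carrier[OF lin, of "mat d d (\<lambda>rc. \<Sum>k\<in>S. c k * A k $$ rc)"] in auto)

lemma linear_op_id: "linear_op d id"
  by (simp add: linear_op_def)

lemma linear_op_comp: "linear_op d \<Phi> \<Longrightarrow> linear_op d \<Psi> \<Longrightarrow> linear_op d (\<Phi> \<circ> \<Psi>)"
  by (simp add: linear_op_def)

lemma linear_op_tensor_map: "linear_op (m * n) (tensor_map m n \<Phi> \<Psi>)"
  unfolding linear_op_def
proof (intro conjI ballI allI)
  fix A B :: "complex mat" and z :: complex
  assume A: "A \<in> carrier_mat (m * n) (m * n)"
  show "tensor_map m n \<Phi> \<Psi> A \<in> carrier_mat (m * n) (m * n)" by (simp add: tensor_map_def)
  show "tensor_map m n \<Phi> \<Psi> (z \<cdot>\<^sub>m A) = z \<cdot>\<^sub>m tensor_map m n \<Phi> \<Psi> A"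
    using A by (intro eq_matI)
      (auto simp: tensor_map_def pair_index_less sum_distrib_left mult.assoc intro!: sum.cong)
  assume B: "B \<in> carrier_mat (m * n) (m * n)"
  show "tensor_map m n \<Phi> \<Psi> (A + B) = tensor_map m n \<Phi> \<Psi> A + tensor_map m n \<Phi> \<Psi> B"
    using A B by (intro eq_matI)
      (auto simp: tensor_map_def pair_index_less distrib_right sum.distrib[symmetric] intro!: sum.cong)
qed

section \<open>Pair indices and extensionality on elementary tensors\<close>

lemma pair_index_cases:
  assumes "r < m * (n::nat)"
  obtains i k where "i < m" "k < n" "r = i * n + k"
proof
  have "n > 0" using assms by (cases n) auto
  then show "r mod n < n" by simp
  show "r div n < m" using assms by (simp add: less_mult_imp_div_less)
qed simp

lemma mat_eq_pairI:
  assumes "A \<in> carrier_mat (m * n) (m * n)" "B \<in> carrier_mat (m * n) (m * n)"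
    and "\<And>i j k l. i < m \<Longrightarrow> j < m \<Longrightarrow> k < n \<Longrightarrow> l < n \<Longrightarrow>
      A $$ (i * n + k, j * n + l) = B $$ (i * n + k, j * n + l)"
  shows "A = B"
proof (rule eq_matI)
  fix r c assume "r < dim_row B" "c < dim_col B"
  then have "r < m * n" "c < m * n" using assms(2) by auto
  then show "A $$ (r, c) = B $$ (r, c)" using assms(3) by (metis pair_index_cases)
qed (use assms in auto)

lemma pair_index_eq_iff:
  assumes "k < n" "k' < n"
  shows "i * n + k = i' * n + (k'::nat) \<longleftrightarrow> i = i' \<and> k = k'"
proof
  assume eq: "i * n + k = i' * n + k'"
  have "(i * n + k) div n = i" "(i' * n + k') div n = i'" using assms by simp_all
  then show "i = i' \<and> k = k'" using eq by simp
qed simp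

text \<open>This is why elementary tensors span: the pair encoding of indices is injective, so a
  product of two delta functions is again a single delta function.\<close>

lemma kron_mat_unit:
  assumes "i < m" "j < m" "k < n" "l < n"
  shows "kron (mat_unit m i j) (mat_unit n k l) = mat_unit (m * n) (i * n + k) (j * n + l)"
proof (rule mat_eq_pairI)
  fix i' j' k' l' assume *: "i' < m" "j' < m" "k' < n" "l' < n"
  show "kron (mat_unit m i j) (mat_unit n k l) $$ (i' * n + k', j' * n + l') =
    mat_unit (m * n) (i * n + k) (j * n + l) $$ (i' * n + k', j' * n + l')"
    using * assms pair_index_less[OF *(1,3)] pair_index_less[OF *(2,4)]
    by (subst kron_index[OF mat_unit_carrier mat_unit_carrier])
      (auto simp: mat_unit_def pair_index_eq_iff)
qed (auto intro: mat_unit_carrier kron_carrier)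

lemma linear_op_eqI:
  assumes "linear_op d \<Phi>" "linear_op d \<Psi>" "X \<in> carrier_mat d d"
    and "\<And>i j. i < d \<Longrightarrow> j < d \<Longrightarrow> \<Phi> (mat_unit d i j) = \<Psi> (mat_unit d i j)"
  shows "\<Phi> X = \<Psi> X"
proof (rule eq_matI)
  have P: "\<Phi> X \<in> carrier_mat d d" "\<Psi> X \<in> carrier_mat d d"
    using assms by (auto intro: linear_op_carrier)
  fix r c assume "r < dim_row (\<Psi> X)" "c < dim_col (\<Psi> X)"
  then have rc: "r < d" "c < d" using P by auto
  show "\<Phi> X $$ (r, c) = \<Psi> X $$ (r, c)"
    using linear_op_expand[OF assms(1,3) rc] linear_op_expand[OF assms(2,3) rc] assms(4)
    by simp
qed (use assms linear_op_carrier in \<open>metis carrier_matD\<close>)+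

text \<open>Every matrix unit of the product space is a Kronecker product, and a linear map is
  determined by its values on matrix units. Together with \<open>tensor_map_kron\<close> this
  settles the identities for composition, flip and mixtures below.\<close>

lemma linear_op_tensor_eqI:
  assumes "linear_op (m * n) S" "linear_op (m * n) T" "X \<in> carrier_mat (m * n) (m * n)"
    and eq: "\<And>A B. A \<in> carrier_mat m m \<Longrightarrow> B \<in> carrier_mat n n \<Longrightarrow> S (kron A B) = T (kron A B)"
  shows "S X = T X"
proof (rule linear_op_eqI[OF assms(1-3)])
  fix r c assume "r < m * n" "c < m * n"
  then obtain i k j l where "i < m" "k < n" "r = i * n + k" "j < m" "l < n" "c = j * n + l"
    by (metis pair_index_cases)
  then show "S (mat_unit (m * n) r c) = T (mat_unit (m * n) r c)"
    using eq[OF mat_unit_carrier mat_unit_carrier, of i j k l] by (simp add: kron_mat_unit)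
qed

lemma tensor_map_comp:
  assumes "linear_op m \<Phi>" "linear_op m \<Phi>'" "linear_op n \<Psi>" "linear_op n \<Psi>'"
    and "X \<in> carrier_mat (m * n) (m * n)"
  shows "tensor_map m n \<Phi> \<Psi> (tensor_map m n \<Phi>' \<Psi>' X) = tensor_map m n (\<Phi> \<circ> \<Phi>') (\<Psi> \<circ> \<Psi>') X"
  by (rule linear_op_tensor_eqI[OF
        linear_op_comp[OF linear_op_tensor_map linear_op_tensor_map, unfolded comp_def] linear_op_tensor_map assms(5)])
    (simp add: tensor_map_kron assms linear_op_comp linear_op_carrier)

text \<open>Equality holds without any reindexing because the row-major encoding is itself
  associative: \<open>(i * n + k) * p + a = i * (n * p) + (k * p + a)\<close>.\<close>

lemma kron_assoc:
  assumes "A \<in> carrier_mat m m" "B \<in> carrier_mat n n" "C \<in> carrier_mat p p"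
  shows "kron (kron A B) C = kron A (kron B C)"
proof -
  note AB = kron_carrier[OF assms(1,2)] and BC = kron_carrier[OF assms(2,3)]
  have A: "kron (kron A B) C \<in> carrier_mat (m * n * p) (m * n * p)"
    "kron A (kron B C) \<in> carrier_mat (m * n * p) (m * n * p)"
    using kron_carrier[OF AB assms(3)] kron_carrier[OF assms(1) BC] by (simp_all add: mult.assoc)
  show ?thesis
  proof (rule mat_eq_pairI[OF A])
    fix r c a b assume rc: "r < m * n" "c < m * n" and ab: "a < p" "b < p"
    obtain i k where ik: "i < m" "k < n" "r = i * n + k" using rc by (metis pair_index_cases)
    obtain j l where jl: "j < m" "l < n" "c = j * n + l" using rc by (metis pair_index_cases)
    have "(i * n + k) * p + a = i * (n * p) + (k * p + a)" "(j * n + l) * p + b = j * (n * p) + (l * p + b)"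
      by (simp_all add: algebra_simps)
    then show "kron (kron A B) C $$ (r * p + a, c * p + b) = kron A (kron B C) $$ (r * p + a, c * p + b)"
      using kron_index[OF AB assms(3) rc ab] kron_index[OF assms(1,2) ik(1) jl(1) ik(2) jl(2)]
        kron_index[OF assms(1) BC ik(1) jl(1) pair_index_less[OF ik(2) ab(1)] pair_index_less[OF jl(2) ab(2)]]
        kron_index[OF assms(2,3) ik(2) jl(2) ab]
      by (simp add: ik(3) jl(3) add.assoc)
  qed
qed

lemma linear_op_tensor3_eqI:
  assumes "linear_op (m * n * p) S" "linear_op (m * n * p) T" "X \<in> carrier_mat (m * n * p) (m * n * p)"
    and eq: "\<And>A B C. A \<in> carrier_mat m m \<Longrightarrow> B \<in> carrier_mat n n \<Longrightarrow> C \<in> carrier_mat p p \<Longrightarrow>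
      S (kron (kron A B) C) = T (kron (kron A B) C)"
  shows "S X = T X"
proof (rule linear_op_eqI[OF assms(1-3)])
  fix r c assume "r < m * n * p" "c < m * n * p"
  then obtain r' a c' b where ab: "r' < m * n" "a < p" "r = r' * p + a" "c' < m * n" "b < p" "c = c' * p + b"
    by (metis pair_index_cases)
  then obtain i k j l where ik: "i < m" "k < n" "r' = i * n + k" "j < m" "l < n" "c' = j * n + l"
    by (metis pair_index_cases)
  show "S (mat_unit (m * n * p) r c) = T (mat_unit (m * n * p) r c)"
    using eq[OF mat_unit_carrier mat_unit_carrier mat_unit_carrier, of i j k l a b] ab ik
    by (simp add: kron_mat_unit)
qed

text \<open>An ancilla of dimension \<open>p\<close> next to the spectator of dimension
  \<open>n\<close> is one ancilla of dimension \<open>n * p\<close> for \<open>\<Phi>\<close>. This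
  is the source of the complete positivity in \<open>channel_tensor_id\<close>.\<close>

lemma tensor_map_assoc_id:
  assumes lin: "linear_op d \<Phi>" and X: "X \<in> carrier_mat (d * n * p) (d * n * p)"
  shows "tensor_map (d * n) p (tensor_map d n \<Phi> id) id X = tensor_map d (n * p) \<Phi> id X"
proof (rule linear_op_tensor3_eqI[OF linear_op_tensor_map _ X])
  show "linear_op (d * n * p) (tensor_map d (n * p) \<Phi> id)"
    using linear_op_tensor_map[of d "n * p"] by (simp add: mult.assoc)
  fix A B C :: "complex mat"
  assume A: "A \<in> carrier_mat d d" and B: "B \<in> carrier_mat n n" and C: "C \<in> carrier_mat p p"
  note PA = linear_op_carrier[OF lin A]
  have "tensor_map (d * n) p (tensor_map d n \<Phi> id) id (kron (kron A B) C) = kron (kron (\<Phi> A) B) C"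
    using kron_carrier[OF A B] A B C by (simp add: tensor_map_kron linear_op_tensor_map linear_op_id lin)
  also have "\<dots> = kron (\<Phi> A) (kron B C)"
    using PA B C by (rule kron_assoc)
  also have "\<dots> = tensor_map d (n * p) \<Phi> id (kron A (kron B C))"
    using kron_carrier[OF B C] A by (simp add: tensor_map_kron linear_op_id lin)
  finally show "tensor_map (d * n) p (tensor_map d n \<Phi> id) id (kron (kron A B) C) =
      tensor_map d (n * p) \<Phi> id (kron (kron A B) C)"
    by (simp add: kron_assoc[OF A B C])
qed

subsection \<open>The flip of the two tensor factors\<close>

text \<open>For \<open>i < m\<close> it sends \<open>k * m + i\<close> to \<open>i * n + k\<close>:
  it reads a position in the swapped ordering and returns the position in the original one, which is
  where \<open>flip\<close> looks up the entry.\<close>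

definition flip_index :: "nat \<Rightarrow> nat \<Rightarrow> nat \<Rightarrow> nat" where
  "flip_index m n r = (r mod m) * n + r div m"

definition flip :: "nat \<Rightarrow> nat \<Rightarrow> complex mat \<Rightarrow> complex mat" where
  "flip m n X = mat (n * m) (n * m) (\<lambda>(r, c). X $$ (flip_index m n r, flip_index m n c))"

lemma flip_index_pair: "i < m \<Longrightarrow> flip_index m n (k * m + i) = i * n + k"
  by (simp add: flip_index_def)

lemma flip_index_less: "r < n * m \<Longrightarrow> flip_index m n r < m * n"
  by (metis flip_index_pair pair_index_cases pair_index_less)

lemma flip_index_flip_index: "r < m * n \<Longrightarrow> flip_index m n (flip_index n m r) = r"
  by (metis flip_index_pair pair_index_cases)

lemma bij_betw_flip_index: "bij_betw (flip_index m n) {..<n * m} {..<m * n}"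
  by (rule bij_betw_byWitness[where f' = "flip_index n m"])
    (auto simp: flip_index_flip_index flip_index_less)

lemma flip_carrier: "flip m n X \<in> carrier_mat (n * m) (n * m)"
  by (simp add: flip_def)

lemma flip_kron:
  assumes "A \<in> carrier_mat m m" "B \<in> carrier_mat n n"
  shows "flip m n (kron A B) = kron B A"
proof (rule mat_eq_pairI[OF flip_carrier kron_carrier[OF assms(2,1)]])
  fix k l i j assume *: "k < n" "l < n" "i < m" "j < m"
  show "flip m n (kron A B) $$ (k * m + i, l * m + j) = kron B A $$ (k * m + i, l * m + j)"
    using * pair_index_less[OF *(1,3)] pair_index_less[OF *(2,4)]
    by (simp add: flip_def flip_index_pair kron_index[OF assms] kron_index[OF assms(2,1)])
qed

lemma linear_op_flip: "linear_op (m * n) (flip m n)"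
  unfolding linear_op_def
proof (intro conjI ballI allI)
  fix A B :: "complex mat" and z :: complex
  assume A: "A \<in> carrier_mat (m * n) (m * n)"
  show "flip m n A \<in> carrier_mat (m * n) (m * n)"
    using flip_carrier[of m n A] by (simp add: mult.commute)
  show "flip m n (z \<cdot>\<^sub>m A) = z \<cdot>\<^sub>m flip m n A"
    using A by (intro eq_matI) (auto simp: flip_def flip_index_less)
  assume B: "B \<in> carrier_mat (m * n) (m * n)"
  show "flip m n (A + B) = flip m n A + flip m n B"
    using A B by (intro eq_matI) (auto simp: flip_def flip_index_less)
qed

lemma linear_op_flip': "linear_op (m * n) (flip n m)"
  using linear_op_flip[of n m] by (simp add: mult.commute)

lemma mat_trace_flip:
  assumes "X \<in> carrier_mat (m * n) (m * n)"
  shows "mat_trace (flip m n X) = mat_trace X"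
proof -
  have "mat_trace (flip m n X) = (\<Sum>r<n * m. X $$ (flip_index m n r, flip_index m n r))"
    by (simp add: mat_trace_def flip_def)
  also have "\<dots> = (\<Sum>r<m * n. X $$ (r, r))"
    by (rule sum.reindex_bij_betw[OF bij_betw_flip_index])
  finally show ?thesis using assms by (simp add: mat_trace_def)
qed

text \<open>Conjugation by the flip exchanges the two maps, as is seen on elementary tensors; it
  reduces statements about the right factor to statements about the left one.\<close>

lemma tensor_map_eq_flip:
  assumes "linear_op m \<Phi>" "linear_op n \<Psi>" "X \<in> carrier_mat (m * n) (m * n)"
  shows "tensor_map m n \<Phi> \<Psi> X = flip n m (tensor_map n m \<Psi> \<Phi> (flip m n X))"
proof (rule linear_op_tensor_eqI[OF linear_op_tensor_map _ assms(3)])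
  have "linear_op (m * n) (tensor_map n m \<Psi> \<Phi>)"
    using linear_op_tensor_map[of n m] by (simp add: mult.commute)
  then show "linear_op (m * n) (\<lambda>X. flip n m (tensor_map n m \<Psi> \<Phi> (flip m n X)))"
    using linear_op_comp[OF linear_op_flip' linear_op_comp[OF _ linear_op_flip]] by (simp add: comp_def)
qed (simp add: flip_kron tensor_map_kron assms linear_op_carrier)

subsection \<open>Channels\<close>

text \<open>Vectors are replaced by arbitrary functions on indices, of which only the values below
  \<open>d\<close> matter. Positivity thus becomes a statement about double sums that can be
  reindexed and split.\<close>

lemma psd_iff_quadratic_form:
  "psd d A \<longleftrightarrow> A \<in> carrier_mat d d \<and>
     (\<forall>v :: nat \<Rightarrow> complex. 0 \<le> (\<Sum>r<d. \<Sum>s<d. A $$ (r, s) * v s * cnj (v r)))"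
proof (cases "A \<in> carrier_mat d d")
  case True
  have eq: "(A *\<^sub>v w) \<bullet>c w = (\<Sum>r<d. \<Sum>s<d. A $$ (r, s) * v s * cnj (v r))"
    if "w = vec d v" for w v
    using True that
    by (auto simp: scalar_prod_def sum_distrib_right atLeast0LessThan intro!: sum.cong)
  have "(\<forall>w \<in> carrier_vec d. P w) \<longleftrightarrow> (\<forall>v. P (vec d v))" for P :: "complex vec \<Rightarrow> bool"
    by (metis carrier_vecD eq_vecI dim_vec index_vec vec_carrier)
  then show ?thesis using True eq by (simp add: psd_def)
qed (simp add: psd_def)

text \<open>Permuting rows and columns simultaneously is conjugation by a permutation matrix. The
  form of the new matrix at \<open>v\<close> equals the form of \<open>A\<close> at
  \<open>w\<close>, which is \<open>v\<close> transported along the inverse permutation.\<close>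

lemma psd_reindex:
  assumes A: "psd d A" and \<pi>: "bij_betw \<pi> {..<d} {..<d}"
  shows "psd d (mat d d (\<lambda>(r, c). A $$ (\<pi> r, \<pi> c)))"
  unfolding psd_iff_quadratic_form
proof (intro conjI allI)
  fix v :: "nat \<Rightarrow> complex"
  define w where "w r = v (the_inv_into {..<d} \<pi> r)" for r
  have w: "w (\<pi> r) = v r" if "r < d" for r
    using that \<pi> by (simp add: w_def bij_betw_def the_inv_into_f_f)
  have "0 \<le> (\<Sum>r<d. \<Sum>s<d. A $$ (r, s) * w s * cnj (w r))"
    using A by (simp add: psd_iff_quadratic_form)
  also have "(\<Sum>r<d. \<Sum>s<d. A $$ (r, s) * w s * cnj (w r)) =
      (\<Sum>r<d. \<Sum>s<d. A $$ (\<pi> r, s) * w s * cnj (w (\<pi> r)))"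
    by (rule sum.reindex_bij_betw[OF \<pi>, symmetric])
  also have "\<dots> = (\<Sum>r<d. \<Sum>s<d. A $$ (\<pi> r, \<pi> s) * w (\<pi> s) * cnj (w (\<pi> r)))"
    by (intro sum.cong refl sum.reindex_bij_betw[OF \<pi>, symmetric])
  finally show "0 \<le> (\<Sum>r<d. \<Sum>s<d. mat d d (\<lambda>(r, c). A $$ (\<pi> r, \<pi> c)) $$ (r, s) * v s * cnj (v r))"
    by (simp add: w)
qed simp

text \<open>Fixing the ancilla indices \<open>k\<close> and \<open>l\<close> cuts a \<open>d\<close>
  by \<open>d\<close> block out of \<open>X\<close>, and the map acts on each of these blocks
  separately.\<close>

lemma tensor_map_id_index:
  assumes lin: "linear_op d \<Phi>" and X: "X \<in> carrier_mat (d * n) (d * n)"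
    and i: "i < d" "j < d" and k: "k < n" "l < n"
  shows "tensor_map d n \<Phi> id X $$ (i * n + k, j * n + l) =
    \<Phi> (mat d d (\<lambda>(i, j). X $$ (i * n + k, j * n + l))) $$ (i, j)"
proof -
  \<comment> \<open>The identity factor contributes matrix units, which act as Kronecker deltas and
    leave only the term at \<open>(k, l)\<close> of the ancilla sums.\<close>
  have *: "(\<Sum>k'<n. \<Sum>l'<n. f k' l' * (c * mat_unit n k' l' $$ (k, l))) = f k l * c" for f :: "nat \<Rightarrow> nat \<Rightarrow> complex" and c
  proof -
    have "(\<Sum>l'<n. f k' l' * (c * mat_unit n k' l' $$ (k, l))) = (if k' = k then f k l * c else 0)" for k'
    proof -
      have "(\<Sum>l'<n. f k' l' * (c * mat_unit n k' l' $$ (k, l))) =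
          (\<Sum>l'<n. if l' = l then (if k' = k then f k l * c else 0) else 0)"
        using k by (intro sum.cong) (auto simp: mat_unit_def)
      then show ?thesis using k by simp
    qed
    then show ?thesis using k by simp
  qed
  show ?thesis
    using i pair_index_less[OF i(1) k(1)] pair_index_less[OF i(2) k(2)]
    by (subst linear_op_expand[OF lin _ i])
      (auto simp: tensor_map_def *
        kron_index[OF linear_op_carrier[OF lin mat_unit_carrier] mat_unit_carrier i k])
qed

lemma channel_linear_op: "channel d \<Phi> \<Longrightarrow> linear_op d \<Phi>"
  by (simp add: channel_def)

lemma psd_carrier: "psd d A \<Longrightarrow> A \<in> carrier_mat d d"
  by (simp add: psd_def)

lemma channel_comp:
  assumes \<Phi>: "channel d \<Phi>" and \<Psi>: "channel d \<Psi>"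
  shows "channel d (\<Phi> \<circ> \<Psi>)"
  unfolding channel_def completely_positive_def
proof (intro conjI allI impI ballI)
  note lin = channel_linear_op[OF \<Phi>] channel_linear_op[OF \<Psi>]
  show "linear_op d (\<Phi> \<circ> \<Psi>)" using lin by (rule linear_op_comp)
  show "mat_trace ((\<Phi> \<circ> \<Psi>) A) = mat_trace A" if "A \<in> carrier_mat d d" for A
    using that \<Phi> \<Psi> linear_op_carrier[OF lin(2)] by (simp add: channel_def)
  fix n X assume X: "psd (d * n) X"
  have "tensor_map d n (\<Phi> \<circ> \<Psi>) id X = tensor_map d n \<Phi> id (tensor_map d n \<Psi> id X)"
    using tensor_map_comp[OF lin linear_op_id linear_op_id psd_carrier[OF X]] by simp
  then show "psd (d * n) (tensor_map d n (\<Phi> \<circ> \<Psi>) id X)"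
    using X \<Phi> \<Psi> by (simp add: channel_def completely_positive_def)
qed

lemma channel_flip: "channel (m * n) (flip m n)"
  unfolding channel_def completely_positive_def
proof (intro conjI allI impI ballI linear_op_flip mat_trace_flip)
  fix p X assume X: "psd (m * n * p) X"
  \<comment> \<open>\<open>\<pi>\<close> flips the system part of an index and leaves its ancilla
    digit, the remainder modulo \<open>p\<close>, unchanged; \<open>\<pi>'\<close> is its inverse.
    Complete positivity then reduces to \<open>psd_reindex\<close>.\<close>
  define \<pi> where "\<pi> r = flip_index m n (r div p) * p + r mod p" for r
  define \<pi>' where "\<pi>' r = flip_index n m (r div p) * p + r mod p" for r
  have \<pi>: "\<pi> (r * p + a) = flip_index m n r * p + a" "\<pi>' (r * p + a) = flip_index n m r * p + a"
    if "a < p" for r a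
    using that by (simp_all add: \<pi>_def \<pi>'_def)
  have less: "\<pi> r < m * n * p" "\<pi>' r < m * n * p" "\<pi> (\<pi>' r) = r" "\<pi>' (\<pi> r) = r"
    if r: "r < m * n * p" for r
  proof -
    obtain q a where q: "q < m * n" "a < p" "r = q * p + a" using r by (rule pair_index_cases)
    then show "\<pi> r < m * n * p" "\<pi>' r < m * n * p" "\<pi> (\<pi>' r) = r" "\<pi>' (\<pi> r) = r"
      using flip_index_less[of q n m] flip_index_less[of q m n] flip_index_flip_index[of q m n]
        flip_index_flip_index[of q n m]
      by (simp_all add: \<pi> pair_index_less mult.commute[of n m])
  qed
  have "bij_betw \<pi> {..<m * n * p} {..<m * n * p}"
    by (rule bij_betw_byWitness[where f' = \<pi>']) (auto simp: less)
  then have "psd (m * n * p) (mat (m * n * p) (m * n * p) (\<lambda>(r, c). X $$ (\<pi> r, \<pi> c)))"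
    using X by (rule psd_reindex[rotated])
  also have "mat (m * n * p) (m * n * p) (\<lambda>(r, c). X $$ (\<pi> r, \<pi> c)) = tensor_map (m * n) p (flip m n) id X"
  proof (rule mat_eq_pairI)
    fix r c a b assume *: "r < m * n" "c < m * n" "a < p" "b < p"
    then have "flip_index m n r < m * n" "flip_index m n c < m * n"
      using flip_index_less[of _ n m] by (simp_all add: mult.commute)
    then show "mat (m * n * p) (m * n * p) (\<lambda>(r, c). X $$ (\<pi> r, \<pi> c)) $$ (r * p + a, c * p + b) =
        tensor_map (m * n) p (flip m n) id X $$ (r * p + a, c * p + b)"
      using * pair_index_less[OF *(1,3)] pair_index_less[OF *(2,4)]
      \<comment> \<open>The block of \<open>X\<close> at the ancilla indices \<open>(a, b)\<close>
        is flipped on its own, which is exactly what \<open>\<pi>\<close> does to the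
        indices.\<close>
      by (subst tensor_map_id_index[OF linear_op_flip psd_carrier[OF X] *])
        (simp add: \<pi> flip_def mult.commute[of n m])
  qed (simp_all add: tensor_map_def)
  finally show "psd (m * n * p) (tensor_map (m * n) p (flip m n) id X)" .
qed

section \<open>Trace preservation of tensor products\<close>

lemma mat_trace_kron:
  assumes "A \<in> carrier_mat m m" "B \<in> carrier_mat n n"
  shows "mat_trace (kron A B) = mat_trace A * mat_trace B"
proof -
  have "r mod n < n" if "r < m * n" for r
    using that by (cases n) auto
  then have "bij_betw (\<lambda>(i, k). i * n + k) ({..<m} \<times> {..<n}) {..<m * n}"
    by (intro bij_betw_byWitness[where f' = "\<lambda>r. (r div n, r mod n)"])
      (auto simp: pair_index_less less_mult_imp_div_less)
  then have "(\<Sum>r<m * n. kron A B $$ (r, r)) =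
      (\<Sum>(i, k)\<in>{..<m} \<times> {..<n}. kron A B $$ (i * n + k, i * n + k))"
    by (subst sum.reindex_bij_betw[symmetric]) (auto intro!: sum.cong)
  also have "\<dots> = (\<Sum>i<m. \<Sum>k<n. A $$ (i, i) * B $$ (k, k))"
    using assms by (simp add: sum.cartesian_product[symmetric] kron_index)
  finally show ?thesis
    using assms kron_carrier[OF assms] by (simp add: mat_trace_def sum_product)
qed

lemma mat_trace_linear_op:
  assumes lin: "linear_op d \<Phi>" and A: "A \<in> carrier_mat d d"
  shows "mat_trace (\<Phi> A) = (\<Sum>i<d. \<Sum>j<d. A $$ (i, j) * mat_trace (\<Phi> (mat_unit d i j)))"
proof -
  have "mat_trace (\<Phi> A) = (\<Sum>r<d. \<Sum>i<d. \<Sum>j<d. A $$ (i, j) * \<Phi> (mat_unit d i j) $$ (r, r))"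
    using linear_op_carrier[OF lin A] by (simp add: mat_trace_def linear_op_expand[OF lin A])
  also have "\<dots> = (\<Sum>i<d. \<Sum>r<d. \<Sum>j<d. A $$ (i, j) * \<Phi> (mat_unit d i j) $$ (r, r))"
    by (rule sum.swap)
  also have "\<dots> = (\<Sum>i<d. \<Sum>j<d. \<Sum>r<d. A $$ (i, j) * \<Phi> (mat_unit d i j) $$ (r, r))"
    by (intro sum.cong refl sum.swap)
  finally show ?thesis
    by (simp add: mat_trace_def sum_distrib_left carrier_matD[OF linear_op_carrier[OF lin mat_unit_carrier]])
qed

lemma mat_trace_tensor_map:
  assumes \<Phi>: "linear_op m \<Phi>" "\<And>A. A \<in> carrier_mat m m \<Longrightarrow> mat_trace (\<Phi> A) = mat_trace A"
    and \<Psi>: "linear_op n \<Psi>" "\<And>B. B \<in> carrier_mat n n \<Longrightarrow> mat_trace (\<Psi> B) = mat_trace B"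
    and X: "X \<in> carrier_mat (m * n) (m * n)"
  shows "mat_trace (tensor_map m n \<Phi> \<Psi> X) = mat_trace X"
proof -
  \<comment> \<open>The right-hand side is written through \<open>id\<close> so that
    \<open>mat_trace_linear_op\<close> expands both traces with the same coefficients, leaving only
    matrix units to compare.\<close>
  have "mat_trace (tensor_map m n \<Phi> \<Psi> (mat_unit (m * n) r c)) = mat_trace (id (mat_unit (m * n) r c))"
    if rc: "r < m * n" "c < m * n" for r c
  proof -
    obtain i k j l where *: "i < m" "k < n" "r = i * n + k" "j < m" "l < n" "c = j * n + l"
      using rc by (metis pair_index_cases)
    have "mat_unit (m * n) r c = kron (mat_unit m i j) (mat_unit n k l)"
      using * by (simp add: kron_mat_unit)
    then show ?thesis
      by (simp add: tensor_map_kron \<Phi> \<Psi> mat_unit_carrier linear_op_carrier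
          mat_trace_kron[of _ m _ n])
  qed
  then show ?thesis
    using mat_trace_linear_op[OF linear_op_tensor_map X] mat_trace_linear_op[OF linear_op_id X] by simp
qed

lemma channel_tensor_id:
  assumes \<Phi>: "channel d \<Phi>"
  shows "channel (d * n) (tensor_map d n \<Phi> id)"
  unfolding channel_def completely_positive_def
proof (intro conjI allI impI ballI linear_op_tensor_map)
  show "mat_trace (tensor_map d n \<Phi> id A) = mat_trace A" if "A \<in> carrier_mat (d * n) (d * n)" for A
    using \<Phi> that by (intro mat_trace_tensor_map linear_op_id) (auto simp: channel_def)
  fix p X assume X: "psd (d * n * p) X"
  then show "psd (d * n * p) (tensor_map (d * n) p (tensor_map d n \<Phi> id) id X)"
    using \<Phi> unfolding tensor_map_assoc_id[OF channel_linear_op[OF \<Phi>] psd_carrier[OF X]]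
    by (simp add: channel_def completely_positive_def mult.assoc)
qed

text \<open>Agreement on the carrier is enough even for complete positivity, because
  \<open>tensor_map\<close> sees its arguments only through their values on matrix units.\<close>

lemma channel_cong:
  assumes "channel d \<Phi>" "\<And>A. A \<in> carrier_mat d d \<Longrightarrow> \<Psi> A = \<Phi> A"
  shows "channel d \<Psi>"
proof -
  have "tensor_map d n \<Psi> id X = tensor_map d n \<Phi> id X" for n X
    using assms(2) by (simp add: tensor_map_def mat_unit_carrier)
  then show ?thesis
    using assms by (simp add: channel_def completely_positive_def linear_op_def)
qed

lemma channel_tensor_map:
  assumes \<Phi>: "channel m \<Phi>" and \<Psi>: "channel n \<Psi>"
  shows "channel (m * n) (tensor_map m n \<Phi> \<Psi>)"
proof (rule channel_cong)
  note lin = channel_linear_op[OF \<Phi>] channel_linear_op[OF \<Psi>]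
  have flip': "channel (m * n) (flip n m)" and \<Psi>': "channel (m * n) (tensor_map n m \<Psi> id)"
    using channel_flip[of n m] channel_tensor_id[OF \<Psi>, of m] by (simp_all add: mult.commute)
  show "channel (m * n) (flip n m \<circ> (tensor_map n m \<Psi> id \<circ> (flip m n \<circ> tensor_map m n \<Phi> id)))"
    by (intro channel_comp flip' \<Psi>' channel_flip channel_tensor_id \<Phi>)
  fix X :: "complex mat" assume X: "X \<in> carrier_mat (m * n) (m * n)"
  have "tensor_map m n \<Phi> \<Psi> X = tensor_map m n id \<Psi> (tensor_map m n \<Phi> id X)"
    using tensor_map_comp[OF linear_op_id lin linear_op_id X] by simp
  then show "tensor_map m n \<Phi> \<Psi> X =
      (flip n m \<circ> (tensor_map n m \<Psi> id \<circ> (flip m n \<circ> tensor_map m n \<Phi> id))) X"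
    using tensor_map_eq_flip[OF linear_op_id lin(2) linear_op_carrier[OF linear_op_tensor_map X]]
    by simp
qed

lemma tensor_map_one_id:
  assumes "linear_op d \<Phi>" "X \<in> carrier_mat d d"
  shows "tensor_map d 1 \<Phi> id X = \<Phi> X"
proof (rule eq_matI)
  have P: "\<Phi> X \<in> carrier_mat d d" using assms by (rule linear_op_carrier)
  then show "dim_row (tensor_map d 1 \<Phi> id X) = dim_row (\<Phi> X)"
    "dim_col (tensor_map d 1 \<Phi> id X) = dim_col (\<Phi> X)"
    by (auto simp: tensor_map_def)
  fix r c assume "r < dim_row (\<Phi> X)" "c < dim_col (\<Phi> X)"
  then have rc: "r < d" "c < d" using P by auto
  have "mat d d (\<lambda>(i, j). X $$ (i, j)) = X" using assms(2) by (intro eq_matI) auto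
  then show "tensor_map d 1 \<Phi> id X $$ (r, c) = \<Phi> X $$ (r, c)"
    using tensor_map_id_index[OF assms(1), of X 1 r c 0 0] assms(2) rc by simp
qed

text \<open>Positivity of \<open>\<Phi>\<close> itself is complete positivity with a one-dimensional
  ancilla, where \<open>tensor_map_one_id\<close> identifies the extended map with
  \<open>\<Phi>\<close>.\<close>

lemma channel_state:
  assumes \<Phi>: "channel d \<Phi>" and \<rho>: "state d \<rho>"
  shows "state d (\<Phi> \<rho>)"
proof -
  have \<rho>': "psd (d * 1) \<rho>" "\<rho> \<in> carrier_mat d d" using \<rho> by (auto simp: state_def psd_def)
  then have "psd (d * 1) (tensor_map d 1 \<Phi> id \<rho>)"
    using \<Phi> unfolding channel_def completely_positive_def by blast
  then show ?thesis
    using \<rho> \<rho>'(2) \<Phi> tensor_map_one_id[OF channel_linear_op[OF \<Phi>] \<rho>'(2)]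
    by (simp add: state_def channel_def)
qed

subsection \<open>Separable states\<close>

lemma separableI:
  fixes K :: nat
  assumes "\<And>k. k < K \<Longrightarrow> 0 \<le> p k" "\<And>k. k < K \<Longrightarrow> state m (\<sigma> k)" "\<And>k. k < K \<Longrightarrow> state n (\<tau> k)"
    and "(\<Sum>k<K. p k) = 1"
    and "\<rho> = mat (m * n) (m * n) (\<lambda>rc. \<Sum>k<K. complex_of_real (p k) * kron (\<sigma> k) (\<tau> k) $$ rc)"
  shows "separable m n \<rho>"
  unfolding separable_def
  by (rule exI[of _ K], rule exI[of _ p], rule exI[of _ \<sigma>], rule exI[of _ \<tau>]) (use assms in simp)

lemma separableE:
  assumes "separable m n \<rho>"
  obtains K :: nat and p :: "nat \<Rightarrow> real" and \<sigma> \<tau>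
  where "\<And>k. k < K \<Longrightarrow> 0 \<le> p k" "\<And>k. k < K \<Longrightarrow> state m (\<sigma> k)" "\<And>k. k < K \<Longrightarrow> state n (\<tau> k)"
    and "(\<Sum>k<K. p k) = 1"
    and "\<rho> = mat (m * n) (m * n) (\<lambda>rc. \<Sum>k<K. complex_of_real (p k) * kron (\<sigma> k) (\<tau> k) $$ rc)"
  using assms unfolding separable_def by (elim exE conjE) (rule that, simp_all)

text \<open>Local maps send each product term to a product of states and keep its weight. Since
  \<open>separable\<close> stores the decomposition as a sum of entries,
  \<open>linear_op_sum\<close> is the form of linearity that applies.\<close>

lemma separable_tensor_map:
  assumes \<Phi>: "linear_op m \<Phi>" "\<And>\<sigma>. state m \<sigma> \<Longrightarrow> state m (\<Phi> \<sigma>)"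
    and \<Psi>: "linear_op n \<Psi>" "\<And>\<tau>. state n \<tau> \<Longrightarrow> state n (\<Psi> \<tau>)"
    and \<rho>: "separable m n \<rho>"
  shows "separable m n (tensor_map m n \<Phi> \<Psi> \<rho>)"
proof -
  obtain K and p :: "nat \<Rightarrow> real" and \<sigma> \<tau> where
    st: "\<And>k. k < K \<Longrightarrow> 0 \<le> p k" "\<And>k. k < K \<Longrightarrow> state m (\<sigma> k)" "\<And>k. k < K \<Longrightarrow> state n (\<tau> k)"
    and p: "(\<Sum>k<K. p k) = 1"
    and \<rho>_eq: "\<rho> = mat (m * n) (m * n) (\<lambda>rc. \<Sum>k<K. complex_of_real (p k) * kron (\<sigma> k) (\<tau> k) $$ rc)"
    using \<rho> by (rule separableE) blast
  have c: "\<sigma> k \<in> carrier_mat m m" "\<tau> k \<in> carrier_mat n n" if "k < K" for k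
    using st(2,3)[OF that] by (auto simp: state_def psd_def)
  have "tensor_map m n \<Phi> \<Psi> \<rho> = mat (m * n) (m * n)
      (\<lambda>rc. \<Sum>k<K. complex_of_real (p k) * tensor_map m n \<Phi> \<Psi> (kron (\<sigma> k) (\<tau> k)) $$ rc)"
    unfolding \<rho>_eq by (rule linear_op_sum[OF linear_op_tensor_map]) (auto intro: kron_carrier c)
  also have "\<dots> = mat (m * n) (m * n)
      (\<lambda>rc. \<Sum>k<K. complex_of_real (p k) * kron (\<Phi> (\<sigma> k)) (\<Psi> (\<tau> k)) $$ rc)"
    using c by (intro arg_cong[where f = "mat (m * n) (m * n)"] ext sum.cong)
      (auto simp: tensor_map_kron \<Phi> \<Psi>)
  finally show ?thesis
    by (intro separableI[where K = K and p = p and \<sigma> = "\<lambda>k. \<Phi> (\<sigma> k)" and \<tau> = "\<lambda>k. \<Psi> (\<tau> k)"])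
      (simp_all add: st p \<Phi>(2) \<Psi>(2))
qed

lemma separable_flip:
  assumes \<rho>: "separable m n \<rho>"
  shows "separable n m (flip m n \<rho>)"
proof -
  obtain K and p :: "nat \<Rightarrow> real" and \<sigma> \<tau> where
    st: "\<And>k. k < K \<Longrightarrow> 0 \<le> p k" "\<And>k. k < K \<Longrightarrow> state m (\<sigma> k)" "\<And>k. k < K \<Longrightarrow> state n (\<tau> k)"
    and p: "(\<Sum>k<K. p k) = 1"
    and \<rho>_eq: "\<rho> = mat (m * n) (m * n) (\<lambda>rc. \<Sum>k<K. complex_of_real (p k) * kron (\<sigma> k) (\<tau> k) $$ rc)"
    using \<rho> by (rule separableE) blast
  have c: "\<sigma> k \<in> carrier_mat m m" "\<tau> k \<in> carrier_mat n n" if "k < K" for k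
    using st(2,3)[OF that] by (auto simp: state_def psd_def)
  have "flip m n \<rho> = mat (m * n) (m * n)
      (\<lambda>rc. \<Sum>k<K. complex_of_real (p k) * flip m n (kron (\<sigma> k) (\<tau> k)) $$ rc)"
    unfolding \<rho>_eq by (rule linear_op_sum[OF linear_op_flip]) (auto intro: kron_carrier c)
  also have "\<dots> = mat (n * m) (n * m)
      (\<lambda>rc. \<Sum>k<K. complex_of_real (p k) * kron (\<tau> k) (\<sigma> k) $$ rc)"
    unfolding mult.commute[of m n]
    using c by (intro arg_cong[where f = "mat (n * m) (n * m)"] ext sum.cong) (auto simp: flip_kron)
  finally show ?thesis
    by (intro separableI[where K = K and p = p and \<sigma> = \<tau> and \<tau> = \<sigma>]) (simp_all add: st p)
qed

lemma separable_convex: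
  assumes \<rho>: "separable m n \<rho>" and \<rho>': "separable m n \<rho>'" and t: "0 \<le> t" "t \<le> 1"
  shows "separable m n (complex_of_real t \<cdot>\<^sub>m \<rho> + complex_of_real (1 - t) \<cdot>\<^sub>m \<rho>')"
proof -
  obtain K and p :: "nat \<Rightarrow> real" and \<sigma> \<tau> where
    st: "\<And>k. k < K \<Longrightarrow> 0 \<le> p k" "\<And>k. k < K \<Longrightarrow> state m (\<sigma> k)" "\<And>k. k < K \<Longrightarrow> state n (\<tau> k)"
    and p: "(\<Sum>k<K. p k) = 1"
    and \<rho>_eq: "\<rho> = mat (m * n) (m * n) (\<lambda>rc. \<Sum>k<K. complex_of_real (p k) * kron (\<sigma> k) (\<tau> k) $$ rc)"
    using \<rho> by (rule separableE) blast
  obtain K' and p' :: "nat \<Rightarrow> real" and \<sigma>' \<tau>' where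
    st': "\<And>k. k < K' \<Longrightarrow> 0 \<le> p' k" "\<And>k. k < K' \<Longrightarrow> state m (\<sigma>' k)" "\<And>k. k < K' \<Longrightarrow> state n (\<tau>' k)"
    and p': "(\<Sum>k<K'. p' k) = 1"
    and \<rho>'_eq: "\<rho>' = mat (m * n) (m * n) (\<lambda>rc. \<Sum>k<K'. complex_of_real (p' k) * kron (\<sigma>' k) (\<tau>' k) $$ rc)"
    using \<rho>' by (rule separableE) blast
  \<comment> \<open>The two decompositions are concatenated: indices below \<open>K\<close> belong
    to \<open>\<rho>\<close> with weights scaled by \<open>t\<close>, and an index \<open>k\<close>
    from \<open>K\<close> on belongs to term \<open>k - K\<close> of \<open>\<rho>'\<close> with
    weight scaled by \<open>1 - t\<close>.\<close>
  define q where "q k = (if k < K then t * p k else (1 - t) * p' (k - K))" for k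
  define \<alpha> where "\<alpha> k = (if k < K then \<sigma> k else \<sigma>' (k - K))" for k
  define \<beta> where "\<beta> k = (if k < K then \<tau> k else \<tau>' (k - K))" for k
  have split: "(\<Sum>k<K + K'. f k) = (\<Sum>k<K. f k) + (\<Sum>k<K'. f (K + k))" for f :: "nat \<Rightarrow> 'c :: comm_monoid_add"
    by (induction K') (auto simp: add.assoc)
  have "0 \<le> q k" "state m (\<alpha> k)" "state n (\<beta> k)" if "k < K + K'" for k
    using that st[of k] st'[of "k - K"] t by (auto simp: q_def \<alpha>_def \<beta>_def)
  moreover have "(\<Sum>k<K + K'. q k) = 1"
    using p p' unfolding split by (simp add: q_def sum_distrib_left[symmetric])
  moreover have "complex_of_real t \<cdot>\<^sub>m \<rho> + complex_of_real (1 - t) \<cdot>\<^sub>m \<rho>' =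
      mat (m * n) (m * n) (\<lambda>rc. \<Sum>k<K + K'. complex_of_real (q k) * kron (\<alpha> k) (\<beta> k) $$ rc)"
    unfolding split \<rho>_eq \<rho>'_eq
    by (intro eq_matI) (auto simp: q_def \<alpha>_def \<beta>_def sum_distrib_left mult.assoc)
  ultimately show ?thesis by (rule separableI)
qed

subsection \<open>Convex combinations\<close>

text \<open>As an abbreviation it makes the map of the final statement literally
  \<open>mix \<mu> \<E> \<F>\<close>, and nested mixtures need no unfolding.\<close>

abbreviation mix ::
  "real \<Rightarrow> (complex mat \<Rightarrow> complex mat) \<Rightarrow> (complex mat \<Rightarrow> complex mat) \<Rightarrow> complex mat \<Rightarrow> complex mat"
where
  "mix t \<Phi> \<Psi> \<equiv> \<lambda>X. complex_of_real t \<cdot>\<^sub>m \<Phi> X + complex_of_real (1 - t) \<cdot>\<^sub>m \<Psi> X"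

lemma linear_op_mix:
  assumes "linear_op d \<Phi>" "linear_op d \<Psi>"
  shows "linear_op d (mix t \<Phi> \<Psi>)"
  unfolding linear_op_def
proof (intro conjI ballI allI)
  fix A B :: "complex mat" and z :: complex
  assume A: "A \<in> carrier_mat d d"
  note cA = linear_op_carrier[OF assms(1) A] linear_op_carrier[OF assms(2) A]
  then show "mix t \<Phi> \<Psi> A \<in> carrier_mat d d" by simp
  show "mix t \<Phi> \<Psi> (z \<cdot>\<^sub>m A) = z \<cdot>\<^sub>m mix t \<Phi> \<Psi> A"
    using A assms by (intro eq_matI) (auto simp: linear_op_def cA[THEN carrier_matD(1)] cA[THEN carrier_matD(2)] algebra_simps)
  assume B: "B \<in> carrier_mat d d"
  note cB = linear_op_carrier[OF assms(1) B] linear_op_carrier[OF assms(2) B]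
  show "mix t \<Phi> \<Psi> (A + B) = mix t \<Phi> \<Psi> A + mix t \<Phi> \<Psi> B"
    using A B assms by (intro eq_matI) (auto simp: linear_op_def cA[THEN carrier_matD(1)] cA[THEN carrier_matD(2)]
        cB[THEN carrier_matD(1)] cB[THEN carrier_matD(2)] algebra_simps)
qed

section \<open>Bilinearity of tensor products and convexity of channels\<close>

lemma kron_lincomb_left:
  assumes A: "A \<in> carrier_mat m m" and A': "A' \<in> carrier_mat m m" and B: "B \<in> carrier_mat n n"
  shows "kron (a \<cdot>\<^sub>m A + b \<cdot>\<^sub>m A') B = a \<cdot>\<^sub>m kron A B + b \<cdot>\<^sub>m kron A' B"
proof (rule mat_eq_pairI)
  have c: "a \<cdot>\<^sub>m A + b \<cdot>\<^sub>m A' \<in> carrier_mat m m" using A A' by simp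
  note k = kron_carrier[OF A B] kron_carrier[OF A' B]
  show "kron (a \<cdot>\<^sub>m A + b \<cdot>\<^sub>m A') B \<in> carrier_mat (m * n) (m * n)" using c B by (rule kron_carrier)
  show "a \<cdot>\<^sub>m kron A B + b \<cdot>\<^sub>m kron A' B \<in> carrier_mat (m * n) (m * n)" using k by simp
  fix i j k l assume *: "i < m" "j < m" "k < n" "l < n"
  show "kron (a \<cdot>\<^sub>m A + b \<cdot>\<^sub>m A') B $$ (i * n + k, j * n + l) =
      (a \<cdot>\<^sub>m kron A B + b \<cdot>\<^sub>m kron A' B) $$ (i * n + k, j * n + l)"
    using * A A' pair_index_less[OF *(1,3)] pair_index_less[OF *(2,4)]
    by (simp add: kron_index[OF c B *] kron_index[OF A B *] kron_index[OF A' B *]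
        carrier_matD[OF k(1)] carrier_matD[OF k(2)] distrib_right)
qed

lemma kron_lincomb_right:
  assumes A: "A \<in> carrier_mat m m" and B: "B \<in> carrier_mat n n" and B': "B' \<in> carrier_mat n n"
  shows "kron A (a \<cdot>\<^sub>m B + b \<cdot>\<^sub>m B') = a \<cdot>\<^sub>m kron A B + b \<cdot>\<^sub>m kron A B'"
proof (rule mat_eq_pairI)
  have c: "a \<cdot>\<^sub>m B + b \<cdot>\<^sub>m B' \<in> carrier_mat n n" using B B' by simp
  note k = kron_carrier[OF A B] kron_carrier[OF A B']
  show "kron A (a \<cdot>\<^sub>m B + b \<cdot>\<^sub>m B') \<in> carrier_mat (m * n) (m * n)" using A c by (rule kron_carrier)
  show "a \<cdot>\<^sub>m kron A B + b \<cdot>\<^sub>m kron A B' \<in> carrier_mat (m * n) (m * n)" using k by simp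
  fix i j k l assume *: "i < m" "j < m" "k < n" "l < n"
  show "kron A (a \<cdot>\<^sub>m B + b \<cdot>\<^sub>m B') $$ (i * n + k, j * n + l) =
      (a \<cdot>\<^sub>m kron A B + b \<cdot>\<^sub>m kron A B') $$ (i * n + k, j * n + l)"
    using * B B' pair_index_less[OF *(1,3)] pair_index_less[OF *(2,4)]
    by (simp add: kron_index[OF A c *] kron_index[OF A B *] kron_index[OF A B' *]
        carrier_matD[OF k(1)] carrier_matD[OF k(2)] distrib_left mult.left_commute)
qed

lemma tensor_map_mix_left:
  assumes \<Phi>: "linear_op m \<Phi>" and \<Phi>': "linear_op m \<Phi>'" and \<Psi>: "linear_op n \<Psi>"
    and X: "X \<in> carrier_mat (m * n) (m * n)"
  shows "tensor_map m n (mix t \<Phi> \<Phi>') \<Psi> X = mix t (tensor_map m n \<Phi> \<Psi>) (tensor_map m n \<Phi>' \<Psi>) X"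
proof (rule linear_op_tensor_eqI[OF linear_op_tensor_map
      linear_op_mix[OF linear_op_tensor_map linear_op_tensor_map] X])
  fix A B :: "complex mat" assume A: "A \<in> carrier_mat m m" and B: "B \<in> carrier_mat n n"
  show "tensor_map m n (mix t \<Phi> \<Phi>') \<Psi> (kron A B) =
      mix t (tensor_map m n \<Phi> \<Psi>) (tensor_map m n \<Phi>' \<Psi>) (kron A B)"
    unfolding tensor_map_kron[OF linear_op_mix[OF \<Phi> \<Phi>'] \<Psi> A B] tensor_map_kron[OF \<Phi> \<Psi> A B]
      tensor_map_kron[OF \<Phi>' \<Psi> A B]
    by (rule kron_lincomb_left[OF linear_op_carrier[OF \<Phi> A] linear_op_carrier[OF \<Phi>' A] linear_op_carrier[OF \<Psi> B]])
qed

lemma tensor_map_mix_right: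
  assumes \<Phi>: "linear_op m \<Phi>" and \<Psi>: "linear_op n \<Psi>" and \<Psi>': "linear_op n \<Psi>'"
    and X: "X \<in> carrier_mat (m * n) (m * n)"
  shows "tensor_map m n \<Phi> (mix t \<Psi> \<Psi>') X = mix t (tensor_map m n \<Phi> \<Psi>) (tensor_map m n \<Phi> \<Psi>') X"
proof (rule linear_op_tensor_eqI[OF linear_op_tensor_map
      linear_op_mix[OF linear_op_tensor_map linear_op_tensor_map] X])
  fix A B :: "complex mat" assume A: "A \<in> carrier_mat m m" and B: "B \<in> carrier_mat n n"
  show "tensor_map m n \<Phi> (mix t \<Psi> \<Psi>') (kron A B) =
      mix t (tensor_map m n \<Phi> \<Psi>) (tensor_map m n \<Phi> \<Psi>') (kron A B)"
    unfolding tensor_map_kron[OF \<Phi> linear_op_mix[OF \<Psi> \<Psi>'] A B] tensor_map_kron[OF \<Phi> \<Psi> A B]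
      tensor_map_kron[OF \<Phi> \<Psi>' A B]
    by (rule kron_lincomb_right[OF linear_op_carrier[OF \<Phi> A] linear_op_carrier[OF \<Psi> B] linear_op_carrier[OF \<Psi>' B]])
qed

lemma psd_convex:
  assumes A: "psd d A" and B: "psd d B" and t: "0 \<le> t" "t \<le> 1"
  shows "psd d (complex_of_real t \<cdot>\<^sub>m A + complex_of_real (1 - t) \<cdot>\<^sub>m B)"
  unfolding psd_iff_quadratic_form
proof (intro conjI allI)
  note c = psd_carrier[OF A] psd_carrier[OF B]
  then show "complex_of_real t \<cdot>\<^sub>m A + complex_of_real (1 - t) \<cdot>\<^sub>m B \<in> carrier_mat d d" by simp
  fix v :: "nat \<Rightarrow> complex"
  let ?q = "\<lambda>A. \<Sum>r<d. \<Sum>s<d. A $$ (r, s) * v s * cnj (v r)"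
  have "?q (complex_of_real t \<cdot>\<^sub>m A + complex_of_real (1 - t) \<cdot>\<^sub>m B) =
      complex_of_real t * ?q A + complex_of_real (1 - t) * ?q B"
    \<comment> \<open>Keeping \<open>complex_of_real (1 - t)\<close> unsplit preserves it as a
      single nonnegative coefficient.\<close>
    using c by (simp add: distrib_right sum.distrib sum_distrib_left mult.assoc del: of_real_diff)
  moreover have "0 \<le> ?q A" "0 \<le> ?q B" using A B by (simp_all add: psd_iff_quadratic_form)
  ultimately show "0 \<le> ?q (complex_of_real t \<cdot>\<^sub>m A + complex_of_real (1 - t) \<cdot>\<^sub>m B)"
    using t by (simp add: less_eq_complex_def)
qed

lemma channel_mix:
  assumes \<Phi>: "channel d \<Phi>" and \<Psi>: "channel d \<Psi>" and t: "0 \<le> t" "t \<le> 1"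
  shows "channel d (mix t \<Phi> \<Psi>)"
  unfolding channel_def completely_positive_def
proof (intro conjI allI impI ballI)
  note lin = channel_linear_op[OF \<Phi>] channel_linear_op[OF \<Psi>]
  show "linear_op d (mix t \<Phi> \<Psi>)" using lin by (rule linear_op_mix)
  show "psd (d * n) (tensor_map d n (mix t \<Phi> \<Psi>) id X)" if X: "psd (d * n) X" for n X
    unfolding tensor_map_mix_left[OF lin linear_op_id psd_carrier[OF X]]
    using \<Phi> \<Psi> X t by (intro psd_convex) (auto simp: channel_def completely_positive_def)
  show "mat_trace (mix t \<Phi> \<Psi> A) = mat_trace A" if A: "A \<in> carrier_mat d d" for A
  proof -
    have "\<Phi> A \<in> carrier_mat d d" "\<Psi> A \<in> carrier_mat d d"
      using linear_op_carrier[OF _ A] lin by auto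
    then have "mat_trace (mix t \<Phi> \<Psi> A) =
        complex_of_real t * mat_trace (\<Phi> A) + complex_of_real (1 - t) * mat_trace (\<Psi> A)"
      by (simp add: mat_trace_def sum.distrib sum_distrib_left del: of_real_diff)
    then show ?thesis
      using \<Phi> \<Psi> A by (simp add: channel_def algebra_simps)
  qed
qed

lemma entanglement_annihilating_mix:
  assumes "entanglement_annihilating \<Phi>" "entanglement_annihilating \<Psi>" "0 \<le> t" "t \<le> 1"
  shows "entanglement_annihilating (mix t \<Phi> \<Psi>)"
  using assms channel_mix separable_convex unfolding entanglement_annihilating_def by blast

lemma entanglement_annihilating_cong:
  assumes "entanglement_annihilating \<Phi>" "\<And>X. X \<in> carrier_mat (2 * 2) (2 * 2) \<Longrightarrow> \<Psi> X = \<Phi> X"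
  shows "entanglement_annihilating \<Psi>"
  using assms channel_cong[of "2 * 2" \<Phi> \<Psi>]
  by (simp add: entanglement_annihilating_def state_def psd_def)

subsection \<open>Tensor products with an entanglement-breaking channel\<close>

lemma entanglement_annihilating_breaking_left:
  assumes \<F>: "entanglement_breaking 2 \<F>" and \<Phi>: "channel 2 \<Phi>"
  shows "entanglement_annihilating (tensor_map 2 2 \<F> \<Phi>)"
  unfolding entanglement_annihilating_def
proof (intro conjI allI impI)
  have "channel 2 \<F>" using \<F> by (simp add: entanglement_breaking_def)
  then show "channel (2 * 2) (tensor_map 2 2 \<F> \<Phi>)" using \<Phi> by (rule channel_tensor_map)
  note lin = channel_linear_op[OF \<open>channel 2 \<F>\<close>] channel_linear_op[OF \<Phi>]
  fix \<rho> assume \<rho>: "state (2 * 2) \<rho>"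
  \<comment> \<open>The second qubit plays the ancilla, so the definition of entanglement breaking
    applies with ancilla dimension 2.\<close>
  have "separable 2 2 (tensor_map 2 2 \<F> id \<rho>)"
    using \<F> \<rho> by (simp add: entanglement_breaking_def)
  then have "separable 2 2 (tensor_map 2 2 id \<Phi> (tensor_map 2 2 \<F> id \<rho>))"
    by (rule separable_tensor_map[OF linear_op_id _ lin(2) channel_state[OF \<Phi>], rotated -1]) simp_all
  then show "separable 2 2 (tensor_map 2 2 \<F> \<Phi> \<rho>)"
    using tensor_map_comp[OF linear_op_id lin linear_op_id, of \<rho>] \<rho> by (simp add: state_def psd_def)
qed

lemma entanglement_annihilating_breaking_right:
  assumes \<F>: "entanglement_breaking 2 \<F>" and \<Phi>: "channel 2 \<Phi>"
  shows "entanglement_annihilating (tensor_map 2 2 \<Phi> \<F>)"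
  unfolding entanglement_annihilating_def
proof (intro conjI allI impI)
  have \<F>': "channel 2 \<F>" using \<F> by (simp add: entanglement_breaking_def)
  with \<Phi> show "channel (2 * 2) (tensor_map 2 2 \<Phi> \<F>)" by (rule channel_tensor_map)
  fix \<rho> assume \<rho>: "state (2 * 2) \<rho>"
  \<comment> \<open>The flipped input has to be a state again before the left version can be applied
    to it.\<close>
  then have "state (2 * 2) (flip 2 2 \<rho>)" by (rule channel_state[OF channel_flip])
  then have "separable 2 2 (tensor_map 2 2 \<F> \<Phi> (flip 2 2 \<rho>))"
    using entanglement_annihilating_breaking_left[OF \<F> \<Phi>] unfolding entanglement_annihilating_def by blast
  then have "separable 2 2 (flip 2 2 (tensor_map 2 2 \<F> \<Phi> (flip 2 2 \<rho>)))"
    by (rule separable_flip)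
  then show "separable 2 2 (tensor_map 2 2 \<Phi> \<F> \<rho>)"
    using \<rho> tensor_map_eq_flip[OF channel_linear_op[OF \<Phi>] channel_linear_op[OF \<F>'], of \<rho>]
    by (simp add: state_def psd_def)
qed

theorem mainTheorem2:
  fixes \<E> \<F> :: "complex mat \<Rightarrow> complex mat" and \<mu> :: real
  assumes "channel 2 \<E>" and "channel 2 \<F>"
    and "two_LEA \<E>"
    and "entanglement_breaking 2 \<F>"
    and "0 \<le> \<mu>" and "\<mu> \<le> 1"
  shows "two_LEA (\<lambda>X. complex_of_real \<mu> \<cdot>\<^sub>m \<E> X + complex_of_real (1 - \<mu>) \<cdot>\<^sub>m \<F> X)"
  unfolding two_LEA_def
proof
  note lin = channel_linear_op[OF assms(1)] channel_linear_op[OF assms(2)]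
  show G: "channel 2 (mix \<mu> \<E> \<F>)"
    using assms by (intro channel_mix)
  \<comment> \<open>Only the right factor of E (x) G is expanded here. The term with E twice is the
    2-LEA hypothesis, and the other one has F on the right.\<close>
  have "entanglement_annihilating (mix \<mu> (tensor_map 2 2 \<E> \<E>) (tensor_map 2 2 \<E> \<F>))"
    using assms(3) entanglement_annihilating_breaking_right[OF assms(4,1)] assms(5,6)
    by (intro entanglement_annihilating_mix) (simp_all add: two_LEA_def)
  then have \<E>G: "entanglement_annihilating (tensor_map 2 2 \<E> (mix \<mu> \<E> \<F>))"
    by (rule entanglement_annihilating_cong) (intro tensor_map_mix_right lin)
  \<comment> \<open>The mixture itself serves as the arbitrary partner channel of F, so this term is
    not expanded further.\<close>
  have "entanglement_annihilating (tensor_map 2 2 \<F> (mix \<mu> \<E> \<F>))"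
    using assms(4) G by (rule entanglement_annihilating_breaking_left)
  with \<E>G have "entanglement_annihilating
      (mix \<mu> (tensor_map 2 2 \<E> (mix \<mu> \<E> \<F>)) (tensor_map 2 2 \<F> (mix \<mu> \<E> \<F>)))"
    using assms(5,6) by (rule entanglement_annihilating_mix)
  then show "entanglement_annihilating (tensor_map 2 2 (mix \<mu> \<E> \<F>) (mix \<mu> \<E> \<F>))"
    by (rule entanglement_annihilating_cong) (intro tensor_map_mix_left lin linear_op_mix)
qed

end
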